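(* Let $(X,T)=\varprojlim (X_n,T)$ be an inverse limit of a sequence of minimal systems $(X_n,T)$, $n\in\mathbb N$, and let $(Y,S)$ be a minimal system. If $X_n$ and $Y$ are quasi-disjoint for each $n\in\mathbb N$, then $X$ and $Y$ are quasi-disjoint.
   Context: A system $(X,T)$ is a compact metric space $X$ with a homeomorphism $T:X\to X$. It is minimal if every orbit $\{T^nx:n\in\mathbb Z\}$ is dense. A factor map (homomorphism) $\pi:(X,T)\to(Y,S)$ is a continuous surjection with $\pi\circ T=S\circ\pi$; inverse limits are taken along factor maps. A system is equicontinuous if for every $\epsilon>0$ there is $\delta>0$ such that $\rho(x,y)<\delta$ implies $\rho(T^nx,T^ny)<\epsilon$ for all $n\in\mathbb Z$. For a minimal system $(X,T)$, $\pi_X:X\to X_{eq}$ denotes its maximal equicontinuous factor (every factor map from $X$ to an equicontinuous system factors through $\pi_X$). A joining of $(X,T)$ and $(Y,S)$ is a closed $T\times S$-invariant subset of $X\times Y$ with full projections onto $X$ and onto $Y$. Minimal systems $(X,T)$, $(Y,S)$ are quasi-disjoint if $X\times Y$ is the only joining $J$ of $X$ and $Y$ satisfying $(\pi_X\times\pi_Y)(J)=X_{eq}\times Y_{eq}$. *)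

theory Defs
  imports "HOL-Analysis.Analysis"
begin

text \<open>A space is an \<open>'a metric\<close>, i.e. a carrier inside a type together with a metric on it. Maps are
  total HOL functions of which only the values on the carrier matter. As in the source, the empty
  system is not excluded.\<close>

definition system :: "'a metric \<Rightarrow> ('a \<Rightarrow> 'a) \<Rightarrow> bool" where
  "system X T \<longleftrightarrow>
     compact_space (mtopology_of X) \<and> homeomorphic_map (mtopology_of X) (mtopology_of X) T"

text \<open>The power \<open>T\<^sup>n\<close> for an integer \<open>n\<close>; the inverse is taken relative to the carrier.\<close>

definition iterate :: "'a metric \<Rightarrow> ('a \<Rightarrow> 'a) \<Rightarrow> int \<Rightarrow> 'a \<Rightarrow> 'a" where
  "iterate X T n = (if 0 \<le> n then T ^^ nat n else inv_into (mspace X) T ^^ nat (- n))"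

definition minimal_system :: "'a metric \<Rightarrow> ('a \<Rightarrow> 'a) \<Rightarrow> bool" where
  "minimal_system X T \<longleftrightarrow> system X T \<and>
     (\<forall>x\<in>mspace X. mtopology_of X closure_of (range (\<lambda>n. iterate X T n x)) = mspace X)"

definition equicontinuous_system :: "'a metric \<Rightarrow> ('a \<Rightarrow> 'a) \<Rightarrow> bool" where
  "equicontinuous_system X T \<longleftrightarrow> system X T \<and>
     (\<forall>\<epsilon>>0. \<exists>\<delta>>0. \<forall>x\<in>mspace X. \<forall>y\<in>mspace X.
        mdist X x y < \<delta> \<longrightarrow> (\<forall>n. mdist X (iterate X T n x) (iterate X T n y) < \<epsilon>))"

definition factor_map ::
  "'a metric \<Rightarrow> ('a \<Rightarrow> 'a) \<Rightarrow> 'b metric \<Rightarrow> ('b \<Rightarrow> 'b) \<Rightarrow> ('a \<Rightarrow> 'b) \<Rightarrow> bool" where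
  "factor_map X T Y S \<pi> \<longleftrightarrow>
     continuous_map (mtopology_of X) (mtopology_of Y) \<pi> \<and> \<pi> ` mspace X = mspace Y \<and>
     (\<forall>x\<in>mspace X. \<pi> (T x) = S (\<pi> x))"

text \<open>The universal property of \<open>\<pi>: X \<rightarrow> Z\<close>. HOL cannot quantify over types here, so \<open>Z\<close> and the
  test systems \<open>W\<close> have points in the type \<open>'a set\<close>. This is no restriction: every factor of \<open>X\<close>
  is isomorphic to one whose points are the fibres of the factor map, which are elements of
  \<open>'a set\<close>; see \<open>max_equicontinuous_factor_universal\<close> below.\<close>

definition max_equicontinuous_factor ::
  "'a metric \<Rightarrow> ('a \<Rightarrow> 'a) \<Rightarrow> 'a set metric \<Rightarrow> ('a set \<Rightarrow> 'a set) \<Rightarrow> ('a \<Rightarrow> 'a set) \<Rightarrow> bool" where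
  "max_equicontinuous_factor X T Z R \<pi> \<longleftrightarrow>
     equicontinuous_system Z R \<and> factor_map X T Z R \<pi> \<and>
     (\<forall>(W :: 'a set metric) Q \<phi>. equicontinuous_system W Q \<and> factor_map X T W Q \<phi> \<longrightarrow>
        (\<exists>\<psi>. factor_map Z R W Q \<psi> \<and> (\<forall>x\<in>mspace X. \<phi> x = \<psi> (\<pi> x))))"

lemma system_bij_betw: "system X T \<Longrightarrow> bij_betw T (mspace X) (mspace X)"
  unfolding system_def bij_betw_def
  by (metis topspace_mtopology_of homeomorphic_imp_injective_map homeomorphic_imp_surjective_map)

lemma funpow_semiconj:
  assumes "\<And>x. x \<in> A \<Longrightarrow> U x \<in> A \<and> \<pi> (U x) = V (\<pi> x)" and "x \<in> A"
  shows "(U ^^ k) x \<in> A \<and> \<pi> ((U ^^ k) x) = (V ^^ k) (\<pi> x)"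
  by (induction k) (use assms in auto)

lemma iterate_semiconj:
  assumes X: "system X T" and Y: "system Y S" and \<pi>: "factor_map X T Y S \<pi>" and x: "x \<in> mspace X"
  shows "iterate X T n x \<in> mspace X \<and> \<pi> (iterate X T n x) = iterate Y S n (\<pi> x)"
proof -
  note bT = system_bij_betw[OF X] and bS = system_bij_betw[OF Y]
  have fw: "T x \<in> mspace X \<and> \<pi> (T x) = S (\<pi> x)" if "x \<in> mspace X" for x
    using that \<pi> bT by (auto simp: factor_map_def bij_betw_def)
  have bw: "inv_into (mspace X) T x \<in> mspace X \<and>
      \<pi> (inv_into (mspace X) T x) = inv_into (mspace Y) S (\<pi> x)" if "x \<in> mspace X" for x
  proof -
    let ?y = "inv_into (mspace X) T x"
    have y: "?y \<in> mspace X" "T ?y = x"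
      using that bT by (auto simp: bij_betw_def intro: inv_into_into f_inv_into_f)
    have "S (\<pi> ?y) = \<pi> x" "\<pi> ?y \<in> mspace Y"
      using y \<pi> by (auto simp: factor_map_def)
    then show ?thesis
      using y bS by (metis bij_betw_inv_into_left)
  qed
  show ?thesis
    using funpow_semiconj[of "mspace X" T \<pi> S, OF fw x]
      funpow_semiconj[of "mspace X" "inv_into (mspace X) T" \<pi> "inv_into (mspace Y) S", OF bw x]
    by (simp add: iterate_def)
qed

lemma factor_map_compose:
  assumes "factor_map A a B b u" "factor_map B b C k v"
  shows "factor_map A a C k (v \<circ> u)"
proof -
  have "continuous_map (mtopology_of A) (mtopology_of C) (v \<circ> u)"
    using assms unfolding factor_map_def by (blast intro: continuous_map_compose)
  moreover have "(v \<circ> u) ` mspace A = mspace C"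
    using assms unfolding factor_map_def by (metis image_comp)
  moreover have "\<forall>x\<in>mspace A. (v \<circ> u) (a x) = k ((v \<circ> u) x)"
    using assms unfolding factor_map_def by fastforce
  ultimately show ?thesis by (simp add: factor_map_def)
qed

lemma max_equicontinuous_factor_universal:
  fixes X :: "'a metric" and W :: "'c metric"
  assumes X: "system X T" and Z: "max_equicontinuous_factor X T Z R \<pi>"
    and W: "equicontinuous_system W Q" and \<phi>: "factor_map X T W Q \<phi>"
  shows "\<exists>\<psi>. factor_map Z R W Q \<psi> \<and> (\<forall>x\<in>mspace X. \<phi> x = \<psi> (\<pi> x))"
proof -
  define c where "c w = {x \<in> mspace X. \<phi> x = w}" for w
  define g where "g = inv_into (mspace W) c"
  define M where "M = c ` mspace W"
  have sys: "system W Q" using W by (simp add: equicontinuous_system_def)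
  have im: "\<phi> ` mspace X = mspace W" using \<phi> by (simp add: factor_map_def)
  have inj: "inj_on c (mspace W)"
  proof (rule inj_onI)
    fix v w assume v: "v \<in> mspace W" and vw: "c v = c w"
    from v im obtain x where "x \<in> mspace X" "\<phi> x = v" by (metis imageE)
    then have "x \<in> c v" by (simp add: c_def)
    then have "x \<in> c w" by (simp only: vw)
    then show "v = w" using \<open>\<phi> x = v\<close> by (simp add: c_def)
  qed
  have gc: "g (c w) = w" if "w \<in> mspace W" for w
    using inj that by (simp add: g_def)
  have gM: "g A \<in> mspace W" "c (g A) = A" if "A \<in> M" for A
    using that gc by (auto simp: M_def)
  interpret MM: Metric_space M "\<lambda>A B. mdist W (g A) (g B)"
  proof
    fix A B C assume "A \<in> M" "B \<in> M"
    then show "mdist W (g A) (g B) = 0 \<longleftrightarrow> A = B"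
      using gM by (metis mdist_zero)
    assume "C \<in> M"
    with \<open>A \<in> M\<close> \<open>B \<in> M\<close> show "mdist W (g A) (g C) \<le> mdist W (g A) (g B) + mdist W (g B) (g C)"
      by (intro mdist_triangle gM)
  qed (simp_all add: mdist_commute)
  define W' where "W' = metric (M, \<lambda>A B. mdist W (g A) (g B))"
  have W': "mspace W' = M" "mdist W' = (\<lambda>A B. mdist W (g A) (g B))"
    by (simp_all add: W'_def)
  interpret P: Metric_space12 "mspace W" "mdist W" "mspace W'" "mdist W'"
    by (simp add: Metric_space12_mspace_mdist)
  interpret P': Metric_space12 "mspace W'" "mdist W'" "mspace W" "mdist W"
    by (simp add: Metric_space12_mspace_mdist)
  have hc: "homeomorphic_map (mtopology_of W) (mtopology_of W') c"
    unfolding mtopology_of_def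
    by (rule P.isometry_imp_homeomorphic_map) (auto simp: W' M_def gc)
  have hg: "homeomorphic_map (mtopology_of W') (mtopology_of W) g"
    unfolding mtopology_of_def
  proof (rule P'.isometry_imp_homeomorphic_map)
    show "g ` mspace W' = mspace W" by (auto simp: W' M_def gc image_iff)
  qed (auto simp: W')
  define Q' where "Q' = c \<circ> Q \<circ> g"
  have hQ: "homeomorphic_map (mtopology_of W) (mtopology_of W) Q"
    using sys by (simp add: system_def)
  have sys': "system W' Q'"
    unfolding system_def
  proof
    show "compact_space (mtopology_of W')"
      using hc sys unfolding system_def
      by (meson homeomorphic_compact_space homeomorphic_map_imp_homeomorphic_space)
    show "homeomorphic_map (mtopology_of W') (mtopology_of W') Q'"
      unfolding Q'_def by (intro homeomorphic_map_compose[OF hg] homeomorphic_map_compose[OF hQ hc])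
  qed
  have QW: "Q w \<in> mspace W" if "w \<in> mspace W" for w
    using system_bij_betw[OF sys] that by (auto simp: bij_betw_def)
  have fc: "factor_map W Q W' Q' c"
    using hc by (auto simp: factor_map_def homeomorphic_imp_continuous_map W' M_def Q'_def gc)
  have fg: "factor_map W' Q' W Q g"
    using hg by (auto simp: factor_map_def homeomorphic_imp_continuous_map W' M_def Q'_def gc QW image_image)
  have eq': "equicontinuous_system W' Q'"
    unfolding equicontinuous_system_def
  proof (intro conjI sys' allI impI)
    fix \<epsilon> :: real assume "\<epsilon> > 0"
    then obtain \<delta> where "\<delta> > 0" and \<delta>: "\<And>x y n. x \<in> mspace W \<Longrightarrow> y \<in> mspace W \<Longrightarrow>
        mdist W x y < \<delta> \<Longrightarrow> mdist W (iterate W Q n x) (iterate W Q n y) < \<epsilon>"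
      using W unfolding equicontinuous_system_def by meson
    show "\<exists>\<delta>>0. \<forall>x\<in>mspace W'. \<forall>y\<in>mspace W'. mdist W' x y < \<delta> \<longrightarrow>
        (\<forall>n. mdist W' (iterate W' Q' n x) (iterate W' Q' n y) < \<epsilon>)"
      using \<open>\<delta> > 0\<close> \<delta> gM iterate_semiconj[OF sys' sys fg] by (intro exI[of _ \<delta>]) (auto simp: W')
  qed
  obtain \<psi> where \<psi>: "factor_map Z R W' Q' \<psi>" "\<forall>x\<in>mspace X. (c \<circ> \<phi>) x = \<psi> (\<pi> x)"
    using Z eq' factor_map_compose[OF \<phi> fc] unfolding max_equicontinuous_factor_def by blast
  have "\<forall>x\<in>mspace X. \<phi> x = (g \<circ> \<psi>) (\<pi> x)"
  proof
    fix x assume x: "x \<in> mspace X"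
    with im have "\<phi> x \<in> mspace W" by blast
    then have "g (c (\<phi> x)) = \<phi> x" by (rule gc)
    moreover have "c (\<phi> x) = \<psi> (\<pi> x)" using \<psi>(2) x by simp
    ultimately show "\<phi> x = (g \<circ> \<psi>) (\<pi> x)" by simp
  qed
  with factor_map_compose[OF \<psi>(1) fg] show ?thesis by blast
qed

definition joining ::
  "'a metric \<Rightarrow> ('a \<Rightarrow> 'a) \<Rightarrow> 'b metric \<Rightarrow> ('b \<Rightarrow> 'b) \<Rightarrow> ('a \<times> 'b) set \<Rightarrow> bool" where
  "joining X T Y S J \<longleftrightarrow>
     closedin (prod_topology (mtopology_of X) (mtopology_of Y)) J \<and> map_prod T S ` J = J \<and>
     fst ` J = mspace X \<and> snd ` J = mspace Y"

text \<open>The maximal equicontinuous factor exists and is unique up to isomorphism over \<open>X\<close>, so the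
  choice of \<open>\<pi>\<^sub>X\<close> and \<open>\<pi>\<^sub>Y\<close> made by the existential quantifier is immaterial.\<close>

definition quasi_disjoint ::
  "'a metric \<Rightarrow> ('a \<Rightarrow> 'a) \<Rightarrow> 'b metric \<Rightarrow> ('b \<Rightarrow> 'b) \<Rightarrow> bool" where
  "quasi_disjoint X T Y S \<longleftrightarrow> minimal_system X T \<and> minimal_system Y S \<and>
     (\<exists>X\<^sub>e T\<^sub>e \<pi>\<^sub>X Y\<^sub>e S\<^sub>e \<pi>\<^sub>Y.
        max_equicontinuous_factor X T X\<^sub>e T\<^sub>e \<pi>\<^sub>X \<and> max_equicontinuous_factor Y S Y\<^sub>e S\<^sub>e \<pi>\<^sub>Y \<and>
        (\<forall>J. joining X T Y S J \<and> map_prod \<pi>\<^sub>X \<pi>\<^sub>Y ` J = mspace X\<^sub>e \<times> mspace Y\<^sub>e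
             \<longleftrightarrow> J = mspace X \<times> mspace Y))"

definition thread_space :: "(nat \<Rightarrow> 'a metric) \<Rightarrow> (nat \<Rightarrow> 'a \<Rightarrow> 'a) \<Rightarrow> (nat \<Rightarrow> 'a) topology" where
  "thread_space Xs f =
     subtopology (product_topology (\<lambda>n. mtopology_of (Xs n)) UNIV) {x. \<forall>n. f n (x (Suc n)) = x n}"

text \<open>\<open>(X, T)\<close> is, via the projections \<open>p n: X \<rightarrow> X\<^sub>n\<close>, isomorphic to the space of threads of the
  inverse sequence with bonding factor maps \<open>f n: X\<^sub>n\<^sub>+\<^sub>1 \<rightarrow> X\<^sub>n\<close>, on which the transformation acts
  coordinatewise. The metric of \<open>X\<close> may be any metric inducing the inverse limit topology.\<close>

definition inverse_limit ::
  "'b metric \<Rightarrow> ('b \<Rightarrow> 'b) \<Rightarrow> (nat \<Rightarrow> 'a metric) \<Rightarrow> (nat \<Rightarrow> 'a \<Rightarrow> 'a) \<Rightarrow> (nat \<Rightarrow> 'a \<Rightarrow> 'a)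
     \<Rightarrow> (nat \<Rightarrow> 'b \<Rightarrow> 'a) \<Rightarrow> bool" where
  "inverse_limit X T Xs Ts f p \<longleftrightarrow> system X T \<and>
     (\<forall>n. factor_map (Xs (Suc n)) (Ts (Suc n)) (Xs n) (Ts n) (f n)) \<and>
     homeomorphic_map (mtopology_of X) (thread_space Xs f) (\<lambda>x n. p n x) \<and>
     (\<forall>n. \<forall>x\<in>mspace X. p n (T x) = Ts n (p n x))"

end

theory Submission
  imports Defs
begin

text \<open>A joining \<open>J\<close> of \<open>X\<close> and \<open>Y\<close> with full image in \<open>X\<^sub>e \<times> Y\<^sub>e\<close> pushes forward to a joining of \<open>X\<^sub>n\<close>
  and \<open>Y\<close>, whose image in the product of the maximal equicontinuous factors is full because that
  of \<open>X\<^sub>n\<close> is a factor of \<open>X\<^sub>e\<close>; so it equals \<open>X\<^sub>n \<times> Y\<close>. Each section of \<open>J\<close> over a point of \<open>Y\<close> is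
  therefore a closed subset of \<open>X\<close> that projects onto every \<open>X\<^sub>n\<close>, and by compactness only \<open>X\<close>
  itself is such a set. No description of \<open>X\<^sub>e\<close> as an inverse limit is needed, only its existence.

  For the existence, equicontinuous factors correspond to continuous invariant pseudometrics. By the
  Lindelof property countably many pseudometrics already separate all the pairs of points that some
  pseudometric separates, and the supremum of these, the \<open>i\<close>-th one truncated at \<open>2\<^sup>-\<^sup>i\<close>, gives the
  largest factor.\<close>

section \<open>Invariant pseudometrics and their quotient systems\<close>

text \<open>All axioms are relative to the carrier. Continuity is asked for only at the diagonal, in
  one variable; with \<open>triangle\<close> this amounts to joint continuity. Invariance is an
  exact equality, so on a system all powers of \<open>T\<close> preserve \<open>d\<close>, and
  equicontinuity of the quotient follows.\<close>

locale invariant_pseudometric =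
  fixes X :: "'a metric" and T :: "'a \<Rightarrow> 'a" and d :: "'a \<Rightarrow> 'a \<Rightarrow> real"
  assumes refl: "x \<in> mspace X \<Longrightarrow> d x x = 0"
    and commute: "x \<in> mspace X \<Longrightarrow> y \<in> mspace X \<Longrightarrow> d x y = d y x"
    and triangle: "x \<in> mspace X \<Longrightarrow> y \<in> mspace X \<Longrightarrow> z \<in> mspace X \<Longrightarrow> d x z \<le> d x y + d y z"
    and nonneg: "x \<in> mspace X \<Longrightarrow> y \<in> mspace X \<Longrightarrow> 0 \<le> d x y"
    and invariant: "x \<in> mspace X \<Longrightarrow> y \<in> mspace X \<Longrightarrow> d (T x) (T y) = d x y"
    and continuous: "x \<in> mspace X \<Longrightarrow> \<epsilon> > 0 \<Longrightarrow>
      \<exists>\<delta>>0. \<forall>y\<in>mspace X. mdist X x y < \<delta> \<longrightarrow> d x y < \<epsilon>"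

lemma invariant_pseudometric_zero: "invariant_pseudometric X T (\<lambda>x y. 0)"
  by unfold_locales (auto intro: exI[of _ 1])

lemma continuous_map_mtopology_of:
  "continuous_map (mtopology_of X) (mtopology_of Y) f \<longleftrightarrow>
    f ` mspace X \<subseteq> mspace Y \<and>
    (\<forall>a\<in>mspace X. \<forall>\<epsilon>>0. \<exists>\<delta>>0. \<forall>x. x \<in> mspace X \<and> mdist X a x < \<delta> \<longrightarrow> mdist Y (f a) (f x) < \<epsilon>)"
  unfolding mtopology_of_def
  by (rule Metric_space.metric_continuous_map) auto

lemma iterate_Suc_right:
  assumes "system X T" "x \<in> mspace X"
  shows "iterate X T n (T x) = iterate X T (n + 1) x"
proof (cases "n \<ge> 0")
  case True
  then show ?thesis by (simp add: iterate_def nat_add_distrib funpow_swap1)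
next
  case False
  define k where "k = nat (- n - 1)"
  have n: "n = - int (Suc k)" using False by (simp add: k_def)
  have "inv_into (mspace X) T (T x) = x"
    using system_bij_betw[OF assms(1)] assms(2) by (simp add: bij_betw_def)
  then have "iterate X T n (T x) = (inv_into (mspace X) T ^^ k) x"
    using n by (simp add: iterate_def funpow_swap1 nat_add_distrib)
  \<comment> \<open>For \<open>k = 0\<close> the exponent \<open>n + 1\<close> is 0, where
    \<open>iterate\<close> already uses its nonnegative branch.\<close>
  also have "\<dots> = iterate X T (n + 1) x" unfolding n by (cases k) (simp_all add: iterate_def nat_add_distrib)
  finally show ?thesis .
qed

lemma (in invariant_pseudometric) iterate_invariant:
  assumes X: "system X T" and x: "x \<in> mspace X" and y: "y \<in> mspace X"
  shows "d (iterate X T n x) (iterate X T n y) = d x y"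
proof -
  note b = system_bij_betw[OF X]
  have idf: "factor_map X T X T id" using X by (simp add: factor_map_def)
  have mem: "iterate X T m z \<in> mspace X" if "z \<in> mspace X" for m z
    using iterate_semiconj[OF X X idf that] by blast
  show ?thesis
  proof (induction n rule: int_induct[of _ 0])
    case base
    show ?case by (simp add: iterate_def)
  next
    case (step1 i)
    have s: "iterate X T (i + 1) z = T (iterate X T i z)" for z
      using step1(1) by (simp add: iterate_def nat_add_distrib)
    show ?case using step1 by (simp add: s invariant mem x y)
  next
    case (step2 i)
    have s: "T (iterate X T (i - 1) z) = iterate X T i z" if "z \<in> mspace X" for z
    proof -
      have e: "nat (- (i - 1)) = Suc (nat (- i))" using step2(1) by simp
      have "iterate X T i z = (inv_into (mspace X) T ^^ nat (- i)) z"
        using step2(1) by (cases "i = 0") (simp_all add: iterate_def)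
      moreover have "iterate X T (i - 1) z = inv_into (mspace X) T ((inv_into (mspace X) T ^^ nat (- i)) z)"
        using step2(1) e by (simp add: iterate_def)
      ultimately show ?thesis
        using b mem[OF that, of i] by (metis bij_betw_inv_into_right)
    qed
    \<comment> \<open>Going down, invariance is applied to the points with index
      \<open>i - 1\<close>, which \<open>T\<close> carries to those with index
      \<open>i\<close>.\<close>
    have "d (iterate X T (i - 1) x) (iterate X T (i - 1) y) =
        d (T (iterate X T (i - 1) x)) (T (iterate X T (i - 1) y))"
      by (simp add: invariant mem x y)
    then show ?case using step2 by (simp add: s x y)
  qed
qed

text \<open>The points of \<open>Z\<close> are the classes of points at \<open>d\<close>-distance 0,
  and \<open>d\<close> descends to a metric on them. The induced map \<open>R\<close> is an isometry
  onto, hence a homeomorphism, and compactness is inherited through the continuous class map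
  \<open>c\<close>.\<close>

lemma (in invariant_pseudometric) quotient_system:
  assumes X: "system X T"
  obtains Z R and \<pi> :: "'a \<Rightarrow> 'a set"
  where "equicontinuous_system Z R" "factor_map X T Z R \<pi>"
    "\<And>x y. x \<in> mspace X \<Longrightarrow> y \<in> mspace X \<Longrightarrow> mdist Z (\<pi> x) (\<pi> y) = d x y"
proof -
  define c where "c x = {y \<in> mspace X. d x y = 0}" for x
  define g where "g A = (SOME x. x \<in> A)" for A :: "'a set"
  define M where "M = c ` mspace X"
  have b: "bij_betw T (mspace X) (mspace X)" by (rule system_bij_betw[OF X])
  then have TX: "T x \<in> mspace X" if "x \<in> mspace X" for x
    using that by (auto simp: bij_betw_def)
  have ceq: "c x = c y \<longleftrightarrow> d x y = 0" if x: "x \<in> mspace X" and y: "y \<in> mspace X" for x y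
  proof
    assume "c x = c y"
    moreover have "y \<in> c y" using y refl by (simp add: c_def)
    ultimately have "y \<in> c x" by blast
    then show "d x y = 0" by (simp add: c_def)
  next
    assume 0: "d x y = 0"
    have "d x z = d y z" if z: "z \<in> mspace X" for z
      using triangle[OF x y z] triangle[OF y x z] commute[OF x y] 0 by simp
    then show "c x = c y" by (auto simp: c_def)
  qed
  have gc: "g (c x) \<in> mspace X" "d x (g (c x)) = 0" if x: "x \<in> mspace X" for x
  proof -
    have "x \<in> c x" using x refl by (simp add: c_def)
    then have "g (c x) \<in> c x" unfolding g_def by (rule someI)
    then show "g (c x) \<in> mspace X" "d x (g (c x)) = 0" by (auto simp: c_def)
  qed
  have cg: "c (g (c x)) = c x" if "x \<in> mspace X" for x
    using ceq gc that by metis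
  have gM: "g A \<in> mspace X" "c (g A) = A" if "A \<in> M" for A
    using that gc cg by (auto simp: M_def)
  \<comment> \<open>The value of \<open>d\<close> does not depend on the representatives: going
    around through them in either direction adds only zero distances.\<close>
  have dg: "d (g (c x)) (g (c y)) = d x y" if x: "x \<in> mspace X" and y: "y \<in> mspace X" for x y
  proof -
    have "d (g (c x)) (g (c y)) \<le> d (g (c x)) x + (d x y + d y (g (c y)))"
      using triangle gc x y by (meson add_left_mono order_trans)
    moreover have "d x y \<le> d x (g (c x)) + (d (g (c x)) (g (c y)) + d (g (c y)) y)"
      using triangle gc x y by (meson add_left_mono order_trans)
    moreover have "d (g (c x)) x = 0" "d (g (c y)) y = 0"
      using gc commute x y by metis+
    ultimately show ?thesis using gc x y by simp
  qed
  \<comment> \<open>The default 0 off \<open>M\<close> is there because \<open>Metric_space\<close>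
    demands nonnegativity and symmetry for all arguments, while \<open>d\<close> is controlled on
    the carrier only.\<close>
  interpret MM: Metric_space M "\<lambda>A B. if A \<in> M \<and> B \<in> M then d (g A) (g B) else 0"
  proof
    fix A B C
    show "0 \<le> (if A \<in> M \<and> B \<in> M then d (g A) (g B) else 0)"
      using nonneg gM by simp
    show "(if A \<in> M \<and> B \<in> M then d (g A) (g B) else 0) = (if B \<in> M \<and> A \<in> M then d (g B) (g A) else 0)"
      using commute gM by simp
    assume "A \<in> M" "B \<in> M"
    then show "(if A \<in> M \<and> B \<in> M then d (g A) (g B) else 0) = 0 \<longleftrightarrow> A = B"
      using gM ceq by metis
    assume "C \<in> M"
    with \<open>A \<in> M\<close> \<open>B \<in> M\<close> show "(if A \<in> M \<and> C \<in> M then d (g A) (g C) else 0) \<le>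
        (if A \<in> M \<and> B \<in> M then d (g A) (g B) else 0) + (if B \<in> M \<and> C \<in> M then d (g B) (g C) else 0)"
      using triangle gM by simp
  qed
  define Z where "Z = metric (M, \<lambda>A B. if A \<in> M \<and> B \<in> M then d (g A) (g B) else 0)"
  have ZM: "mspace Z = M" by (simp add: Z_def)
  have "mdist Z = (\<lambda>A B. if A \<in> M \<and> B \<in> M then d (g A) (g B) else 0)" by (simp add: Z_def)
  then have dist: "mdist Z (c x) (c y) = d x y" if "x \<in> mspace X" "y \<in> mspace X" for x y
    using that dg by (simp add: M_def)
  define R where "R = c \<circ> T \<circ> g"
  have Rc: "R (c x) = c (T x)" if x: "x \<in> mspace X" for x
  proof -
    have "d (T (g (c x))) (T x) = 0" using invariant gc x commute by metis
    then show ?thesis using ceq gc TX x by (simp add: R_def)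
  qed
  have cont: "continuous_map (mtopology_of X) (mtopology_of Z) c"
    unfolding continuous_map_mtopology_of
  proof (intro conjI ballI allI impI)
    show "c ` mspace X \<subseteq> mspace Z" by (simp add: ZM M_def)
    fix a and \<epsilon> :: real assume a: "a \<in> mspace X" "\<epsilon> > 0"
    then show "\<exists>\<delta>>0. \<forall>x. x \<in> mspace X \<and> mdist X a x < \<delta> \<longrightarrow> mdist Z (c a) (c x) < \<epsilon>"
      using continuous[OF a] dist by metis
  qed
  have surj: "c ` mspace X = mspace Z" by (simp add: ZM M_def)
  interpret P: Metric_space12 "mspace Z" "mdist Z" "mspace Z" "mdist Z"
    by (simp add: Metric_space12_mspace_mdist)
  have sysZ: "system Z R"
    unfolding system_def
  proof
    have "compactin (mtopology_of Z) (c ` mspace X)"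
      using image_compactin[OF _ cont] X
      by (metis compact_space_def system_def topspace_mtopology_of)
    then show "compact_space (mtopology_of Z)"
      by (simp add: compact_space_def surj)
    show "homeomorphic_map (mtopology_of Z) (mtopology_of Z) R"
      unfolding mtopology_of_def
    proof (rule P.isometry_imp_homeomorphic_map)
      have "R ` c ` mspace X = c ` T ` mspace X"
        using Rc by (auto simp: image_iff)
      then show "R ` mspace Z = mspace Z"
        using b by (simp add: surj bij_betw_def)
      fix A B assume "A \<in> mspace Z" "B \<in> mspace Z"
      then obtain x y where "x \<in> mspace X" "A = c x" "y \<in> mspace X" "B = c y"
        unfolding surj[symmetric] by blast
      then show "mdist Z (R A) (R B) = mdist Z A B"
        using Rc dist TX invariant by simp
    qed
  qed
  have fm: "factor_map X T Z R c"
    unfolding factor_map_def using cont surj Rc by simp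
  have eq: "equicontinuous_system Z R"
    unfolding equicontinuous_system_def
  proof (intro conjI allI impI sysZ)
    fix \<epsilon> :: real assume "\<epsilon> > 0"
    \<comment> \<open>Every iterate of \<open>R\<close> is an isometry, so \<delta> = \<epsilon>
      will do.\<close>
    have "mdist Z (iterate Z R n A) (iterate Z R n B) = mdist Z A B"
      if AB: "A \<in> mspace Z" "B \<in> mspace Z" for A B n
    proof -
      obtain x y where xy: "x \<in> mspace X" "A = c x" "y \<in> mspace X" "B = c y"
        using AB unfolding surj[symmetric] by blast
      show ?thesis
        using iterate_semiconj[OF X sysZ fm xy(1), of n] iterate_semiconj[OF X sysZ fm xy(3), of n]
          iterate_invariant[OF X xy(1) xy(3), of n] dist xy by metis
    qed
    then show "\<exists>\<delta>>0. \<forall>x\<in>mspace Z. \<forall>y\<in>mspace Z.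
        mdist Z x y < \<delta> \<longrightarrow> (\<forall>n. mdist Z (iterate Z R n x) (iterate Z R n y) < \<epsilon>)"
      using \<open>\<epsilon> > 0\<close> by (intro exI[of _ \<epsilon>]) simp
  qed
  show ?thesis by (rule that[OF eq fm dist])
qed

section \<open>From equicontinuous factors to invariant pseudometrics\<close>

text \<open>Pull back the metric of \<open>W\<close>, truncate it at 1 so that suprema exist, and
  take the supremum over the whole orbit. This enforces invariance, equicontinuity keeps it
  continuous, and the term \<open>n = 0\<close> gives the separation property.\<close>

lemma equicontinuous_factor_pseudometric:
  assumes X: "system X T" and W: "equicontinuous_system W Q" and \<phi>: "factor_map X T W Q \<phi>"
  obtains d where "invariant_pseudometric X T d"
    "\<And>x y. x \<in> mspace X \<Longrightarrow> y \<in> mspace X \<Longrightarrow> d x y = 0 \<Longrightarrow> \<phi> x = \<phi> y"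
proof -
  have sW: "system W Q" using W by (simp add: equicontinuous_system_def)
  define e where "e n x y = min 1 (mdist W (iterate W Q n (\<phi> x)) (iterate W Q n (\<phi> y)))" for n x y
  define d where "d x y = (SUP n. e n x y)" for x y
  have e01: "0 \<le> e n x y" "e n x y \<le> 1" for n x y by (simp_all add: e_def)
  have bdd: "bdd_above (range (\<lambda>n. e n x y))" for x y
    using e01 by (auto intro: bdd_aboveI[of _ 1])
  have upper: "e n x y \<le> d x y" for n x y
    unfolding d_def by (rule cSUP_upper[OF UNIV_I bdd])
  have least: "d x y \<le> K" if "\<And>n. e n x y \<le> K" for x y K
    unfolding d_def using that by (intro cSUP_least) auto
  have \<phi>W: "\<phi> x \<in> mspace W" if "x \<in> mspace X" for x
    using \<phi> that by (auto simp: factor_map_def)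
  have mem: "iterate W Q n (\<phi> x) \<in> mspace W" if "x \<in> mspace X" for n x
    using iterate_semiconj[OF X sW \<phi> that, of n] \<phi>W by metis
  have "invariant_pseudometric X T d"
  proof
    fix x y z assume x: "x \<in> mspace X"
    have "mdist W (iterate W Q n (\<phi> x)) (iterate W Q n (\<phi> x)) = 0" for n
      using mem[OF x] by simp
    then show "d x x = 0" by (simp add: d_def e_def)
    assume y: "y \<in> mspace X"
    show "d x y = d y x" by (simp add: d_def e_def mdist_commute)
    show "0 \<le> d x y" using e01 upper order_trans by blast
    \<comment> \<open>Applying \<open>T\<close> to both points only shifts the index, and the shift
      maps the integers onto themselves.\<close>
    have "d (T x) (T y) = (SUP n. e (n + 1) x y)"
      using \<phi> x y iterate_Suc_right[OF sW \<phi>W] by (simp add: d_def e_def factor_map_def)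
    also have "range (\<lambda>n. e (n + 1) x y) = (\<lambda>n. e n x y) ` range (\<lambda>n. n + 1)"
      by (simp only: image_image)
    also have "range (\<lambda>n::int. n + 1) = UNIV"
      by (metis diff_add_cancel surjI)
    finally show "d (T x) (T y) = d x y" by (simp add: d_def)
    assume z: "z \<in> mspace X"
    show "d x z \<le> d x y + d y z"
    proof (rule least)
      fix n
      have "e n x z \<le> e n x y + e n y z"
        using mdist_triangle[OF mem[OF x, of n] mem[OF y, of n] mem[OF z, of n]]
          mdist_nonneg[of W "iterate W Q n (\<phi> x)" "iterate W Q n (\<phi> y)"]
          mdist_nonneg[of W "iterate W Q n (\<phi> y)" "iterate W Q n (\<phi> z)"]
        unfolding e_def by linarith
      also have "\<dots> \<le> d x y + d y z" by (intro add_mono upper)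
      finally show "e n x z \<le> d x y + d y z" .
    qed
  next
    fix x and \<epsilon> :: real assume x: "x \<in> mspace X" and "\<epsilon> > 0"
    \<comment> \<open>Half of \<epsilon>, because a supremum of terms below a bound is only known to
      be at most that bound.\<close>
    then have "\<epsilon>/2 > 0" by simp
    then obtain \<delta> where "\<delta> > 0" and \<delta>: "\<And>x y n. x \<in> mspace W \<Longrightarrow> y \<in> mspace W \<Longrightarrow>
        mdist W x y < \<delta> \<Longrightarrow> mdist W (iterate W Q n x) (iterate W Q n y) < \<epsilon>/2"
      using W unfolding equicontinuous_system_def by meson
    have "continuous_map (mtopology_of X) (mtopology_of W) \<phi>"
      using \<phi> by (simp add: factor_map_def)
    then obtain \<eta> where "\<eta> > 0" and \<eta>: "\<And>y. y \<in> mspace X \<Longrightarrow> mdist X x y < \<eta> \<Longrightarrow> mdist W (\<phi> x) (\<phi> y) < \<delta>"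
      unfolding continuous_map_mtopology_of using x \<open>\<delta> > 0\<close> by metis
    have "d x y < \<epsilon>" if y: "y \<in> mspace X" "mdist X x y < \<eta>" for y
    proof -
      have "d x y \<le> \<epsilon>/2"
      proof (rule least)
        fix n
        have "mdist W (iterate W Q n (\<phi> x)) (iterate W Q n (\<phi> y)) < \<epsilon>/2"
          using \<delta> \<eta>[OF y] \<phi>W x y by blast
        then show "e n x y \<le> \<epsilon>/2" by (simp add: e_def)
      qed
      then show ?thesis using \<open>\<epsilon> > 0\<close> by simp
    qed
    then show "\<exists>\<delta>>0. \<forall>y\<in>mspace X. mdist X x y < \<delta> \<longrightarrow> d x y < \<epsilon>"
      using \<open>\<eta> > 0\<close> by blast
  qed
  moreover have "\<phi> x = \<phi> y" if "x \<in> mspace X" "y \<in> mspace X" "d x y = 0" for x y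
  proof -
    have "e 0 x y \<le> 0" using upper[of 0 x y] that by simp
    then have "mdist W (\<phi> x) (\<phi> y) \<le> 0" by (simp add: e_def iterate_def)
    then have "mdist W (\<phi> x) (\<phi> y) = 0" by (intro antisym mdist_nonneg)
    then show ?thesis using \<phi>W that by simp
  qed
  ultimately show ?thesis by (rule that)
qed

section \<open>The largest invariant pseudometric\<close>

text \<open>Truncating the \<open>n\<close>-th pseudometric at \<open>(1/2)^n\<close> leaves its
  zero set unchanged and makes the tail uniformly small, so continuity at a point is a matter of
  finitely many terms.\<close>

lemma invariant_pseudometric_SUP:
  assumes D: "\<And>i::nat. invariant_pseudometric X T (D i)"
  obtains d where "invariant_pseudometric X T d"
    "\<And>x y i. x \<in> mspace X \<Longrightarrow> y \<in> mspace X \<Longrightarrow> d x y = 0 \<Longrightarrow> D i x y = 0"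
proof -
  define e where "e n x y = min ((1/2)^n) (D n x y)" for n x y
  define d where "d x y = (SUP n. e n x y)" for x y
  note nn = invariant_pseudometric.nonneg[OF D]
  have e1: "e n x y \<le> 1" for n x y
    by (simp add: e_def min.coboundedI1 power_le_one)
  have e0: "0 \<le> e n x y" if "x \<in> mspace X" "y \<in> mspace X" for n x y
    using nn that by (simp add: e_def)
  have bdd: "bdd_above (range (\<lambda>n. e n x y))" for x y
    using e1 by (auto intro: bdd_aboveI[of _ 1])
  have upper: "e n x y \<le> d x y" for n x y
    unfolding d_def by (rule cSUP_upper[OF UNIV_I bdd])
  have least: "d x y \<le> K" if "\<And>n. e n x y \<le> K" for x y K
    unfolding d_def using that by (intro cSUP_least) auto
  have "invariant_pseudometric X T d"
  proof
    fix x y z assume x: "x \<in> mspace X"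
    show "d x x = 0" using invariant_pseudometric.refl[OF D x] by (simp add: d_def e_def)
    assume y: "y \<in> mspace X"
    show "d x y = d y x" using invariant_pseudometric.commute[OF D x y] by (simp add: d_def e_def)
    show "0 \<le> d x y" using e0[OF x y] upper order_trans by blast
    show "d (T x) (T y) = d x y"
      using invariant_pseudometric.invariant[OF D x y] by (simp add: d_def e_def)
    assume z: "z \<in> mspace X"
    show "d x z \<le> d x y + d y z"
    proof (rule least)
      fix n
      have "e n x z \<le> e n x y + e n y z"
        using invariant_pseudometric.triangle[OF D x y z, of n] nn[OF x y, of n] nn[OF y z, of n]
          zero_le_power[of "1/2::real" n]
        unfolding e_def by linarith
      also have "\<dots> \<le> d x y + d y z" by (intro add_mono upper)
      finally show "e n x z \<le> d x y + d y z" .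
    qed
  next
    fix x and \<epsilon> :: real assume x: "x \<in> mspace X" and "\<epsilon> > 0"
    then have e2: "\<epsilon>/2 > 0" by simp
    obtain N where N: "(1/2)^N < \<epsilon>/2"
      using real_arch_pow_inv[OF e2, of "1/2"] by auto
    obtain \<delta> where \<delta>: "\<And>i. \<delta> i > 0" "\<And>i y. y \<in> mspace X \<Longrightarrow> mdist X x y < \<delta> i \<Longrightarrow> D i x y < \<epsilon>/2"
      using invariant_pseudometric.continuous[OF D x e2] by metis
    \<comment> \<open>Only indices up to \<open>N\<close> restrict the radius; later terms are below
      \<epsilon>/2 by truncation.\<close>
    define \<eta> where "\<eta> = Min (\<delta> ` {..N})"
    have "\<eta> > 0" by (simp add: \<eta>_def \<delta>)
    have "d x y < \<epsilon>" if y: "y \<in> mspace X" "mdist X x y < \<eta>" for y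
    proof -
      have "d x y \<le> \<epsilon>/2"
      proof (rule least)
        fix n
        show "e n x y \<le> \<epsilon>/2"
        proof (cases "n \<le> N")
          case True
          then have "mdist X x y < \<delta> n" using y(2) by (simp add: \<eta>_def)
          then have "D n x y < \<epsilon>/2" by (rule \<delta>(2)[OF y(1)])
          then show ?thesis unfolding e_def by linarith
        next
          case False
          then have "(1/2::real)^n \<le> (1/2)^N" by (intro power_decreasing) auto
          then show ?thesis using N unfolding e_def by linarith
        qed
      qed
      then show ?thesis using \<open>\<epsilon> > 0\<close> by simp
    qed
    then show "\<exists>\<delta>>0. \<forall>y\<in>mspace X. mdist X x y < \<delta> \<longrightarrow> d x y < \<epsilon>"
      using \<open>\<eta> > 0\<close> by blast
  qed
  moreover have "D i x y = 0" if "x \<in> mspace X" "y \<in> mspace X" "d x y = 0" for x y i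
    using upper[of i x y] that(3) nn[OF that(1,2), of i] zero_less_power[of "1/2::real" i]
    unfolding e_def by linarith
  ultimately show ?thesis by (rule that)
qed

text \<open>Total boundedness gives a finite net for each radius \<open>1 / real (Suc n)\<close>;
  \<open>A\<close> is the union of these nets.\<close>

lemma compact_countable_dense:
  assumes "compact_space (mtopology_of X)"
  obtains A where "countable A" "A \<subseteq> mspace X"
    "\<And>x \<epsilon>. x \<in> mspace X \<Longrightarrow> \<epsilon> > 0 \<Longrightarrow> \<exists>a\<in>A. mdist X a x < \<epsilon>"
proof -
  interpret Metric_space "mspace X" "mdist X" by simp
  have "mtotally_bounded (mspace X)"
    using assms compact_space_eq_mcomplete_mtotally_bounded by (simp add: mtopology_of_def)
  then have "\<exists>K. finite K \<and> K \<subseteq> mspace X \<and> mspace X \<subseteq> (\<Union>x\<in>K. mball x (1 / real (Suc n)))" for n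
    unfolding mtotally_bounded_def by (simp del: of_nat_Suc)
  then obtain K where K: "\<And>n. finite (K n)" "\<And>n. K n \<subseteq> mspace X"
    "\<And>n. mspace X \<subseteq> (\<Union>x\<in>K n. mball x (1 / real (Suc n)))" by metis
  show ?thesis
  proof (rule that[of "\<Union>n. K n"])
    show "countable (\<Union>n. K n)" using K(1) by (auto intro: countable_finite)
    show "(\<Union>n. K n) \<subseteq> mspace X" using K(2) by blast
    fix x and \<epsilon> :: real assume x: "x \<in> mspace X" and "\<epsilon> > 0"
    then obtain n where n: "1 / real (Suc n) < \<epsilon>" by (meson nat_approx_posE)
    obtain a where "a \<in> K n" "x \<in> mball a (1 / real (Suc n))" using K(3)[of n] x by blast
    then show "\<exists>a\<in>\<Union>n. K n. mdist X a x < \<epsilon>" using n by (intro bexI[of _ a]) auto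
  qed
qed

text \<open>If some \<open>e\<close> separates \<open>x\<close> from \<open>y\<close>, it separates
  all points of two small balls around them, and these may be taken from a countable family. The
  separator chosen for that pair of balls is among the countably many whose zero sets contain that
  of \<open>d\<close>.\<close>

lemma max_invariant_pseudometric:
  assumes X: "system X T"
  obtains d where "invariant_pseudometric X T d"
    "\<And>e x y. invariant_pseudometric X T e \<Longrightarrow> x \<in> mspace X \<Longrightarrow> y \<in> mspace X \<Longrightarrow>
      d x y = 0 \<Longrightarrow> e x y = 0"
proof -
  obtain A where A: "countable A" "A \<subseteq> mspace X"
    "\<And>x \<epsilon>. x \<in> mspace X \<Longrightarrow> \<epsilon> > 0 \<Longrightarrow> \<exists>a\<in>A. mdist X a x < \<epsilon>"
    using X compact_countable_dense unfolding system_def by metis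
  \<comment> \<open>\<open>good (a, b, k) e\<close>: the zero set of \<open>e\<close> misses the
    product of the balls of radius \<open>1 / real (Suc k)\<close> about \<open>a\<close> and
    \<open>b\<close>.\<close>
  define good where "good = (\<lambda>(a, b, k::nat) e. invariant_pseudometric X T e \<and>
    (\<forall>x\<in>mspace X. \<forall>y\<in>mspace X. mdist X a x < 1 / real (Suc k) \<longrightarrow> mdist X b y < 1 / real (Suc k) \<longrightarrow> e x y \<noteq> 0))"
  \<comment> \<open>One pseudometric for each pair of balls, with centres in \<open>A\<close>, that some pseudometric separates.\<close>
  define pick where "pick t = (if \<exists>e. good t e then SOME e. good t e else (\<lambda>x y. 0))" for t
  have good_pick: "good t (pick t)" if "good t e" for t e
    using that unfolding pick_def by (simp add: someI_ex[of "good t"] exI[of "good t"])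
  have pick: "invariant_pseudometric X T (pick t)" for t
  proof (cases "\<exists>e. good t e")
    case True
    then have "good t (pick t)" using good_pick by blast
    then show ?thesis by (cases t) (simp add: good_def)
  next
    case False
    then show ?thesis by (simp add: pick_def invariant_pseudometric_zero)
  qed
  define I where "I = A \<times> A \<times> (UNIV::nat set)"
  have I: "countable I" using A(1) by (simp add: I_def)
  \<comment> \<open>\<open>pick\<close> yields a pseudometric at every triple, so also when
    \<open>I\<close> is empty and \<open>from_nat_into\<close> returns an arbitrary one.\<close>
  obtain d where d: "invariant_pseudometric X T d" 
    and d0: "\<And>x y i. x \<in> mspace X \<Longrightarrow> y \<in> mspace X \<Longrightarrow> d x y = 0 \<Longrightarrow> pick (from_nat_into I i) x y = 0"
    using invariant_pseudometric_SUP[of X T "\<lambda>i. pick (from_nat_into I i)"] pick by metis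
  have "e x y = 0" if e: "invariant_pseudometric X T e" and x: "x \<in> mspace X" and y: "y \<in> mspace X"
    and 0: "d x y = 0" for e x y
  proof (rule ccontr)
    interpret e: invariant_pseudometric X T e by (rule e)
    assume "e x y \<noteq> 0"
    \<comment> \<open>Moving each point by less than half of \<open>e x y\<close> cannot bring the
      distance down to 0.\<close>
    then have pos: "e x y / 2 > 0" using e.nonneg[OF x y] by simp
    obtain r s where "r > 0" "s > 0" and r: "\<And>z. z \<in> mspace X \<Longrightarrow> mdist X x z < r \<Longrightarrow> e x z < e x y / 2"
      and s: "\<And>z. z \<in> mspace X \<Longrightarrow> mdist X y z < s \<Longrightarrow> e y z < e x y / 2"
      using e.continuous[OF x pos] e.continuous[OF y pos] by metis
    \<comment> \<open>Half of the radius, since the ball is centred at a nearby point of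
      \<open>A\<close>: the triangle inequality through that centre doubles it.\<close>
    obtain k where k: "1 / real (Suc k) < min r s / 2"
      using \<open>r > 0\<close> \<open>s > 0\<close> nat_approx_posE[of "min r s / 2"] by auto
    have k0: "1 / real (Suc k) > 0" by simp
    obtain a b where a: "a \<in> A" "mdist X a x < 1 / real (Suc k)" and b: "b \<in> A" "mdist X b y < 1 / real (Suc k)"
      using A(3)[OF x k0] A(3)[OF y k0] by blast
    have "e u v \<noteq> 0" if u: "u \<in> mspace X" "mdist X a u < 1 / real (Suc k)"
      and v: "v \<in> mspace X" "mdist X b v < 1 / real (Suc k)" for u v
    proof
      assume uv: "e u v = 0"
      have "mdist X x u \<le> mdist X x a + mdist X a u" "mdist X y v \<le> mdist X y b + mdist X b v"
        using a b A(2) x y u v by (auto intro!: mdist_triangle)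
      then have "mdist X x u < r" "mdist X y v < s"
        using a b u v k by (simp_all add: mdist_commute[of X x] mdist_commute[of X y])
      then have "e x u < e x y / 2" "e y v < e x y / 2" using r s u v by auto
      then show False
        using e.triangle[OF x u(1) y] e.triangle[OF u(1) v(1) y] e.commute[OF y v(1)] uv by simp
    qed
    then have "good (a, b, k) e" using e by (auto simp: good_def)
    then have "good (a, b, k) (pick (a, b, k))" by (rule good_pick)
    then have "pick (a, b, k) x y \<noteq> 0" using a b x y by (auto simp: good_def)
    moreover have "(a, b, k) \<in> I" using a b by (simp add: I_def)
    then obtain i where "from_nat_into I i = (a, b, k)"
      using from_nat_into_surj[OF I] by blast
    ultimately show False using d0[OF x y 0, of i] by simp
  qed
  with d show ?thesis by (rule that)
qed

section \<open>Existence of the maximal equicontinuous factor\<close>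

lemma Hausdorff_space_mtopology_of: "Hausdorff_space (mtopology_of X)"
  unfolding mtopology_of_def by (rule Metric_space.Hausdorff_space_mtopology) simp

text \<open>\<open>Z\<close> is the quotient by the largest pseudometric \<open>d\<close>. A factor
  map \<phi> to an equicontinuous system has its own pseudometric, which vanishes wherever
  \<open>d\<close> does, so \<phi> is constant on the fibres of \<pi> and descends to
  \<open>Z\<close>.\<close>

lemma max_equicontinuous_factor_exists:
  fixes X :: "'a metric"
  assumes X: "system X T"
  shows "\<exists>Z R \<pi>. max_equicontinuous_factor X T Z R \<pi>"
proof -
  obtain d where d: "invariant_pseudometric X T d"
    and max: "\<And>e x y. invariant_pseudometric X T e \<Longrightarrow> x \<in> mspace X \<Longrightarrow> y \<in> mspace X \<Longrightarrow>
      d x y = 0 \<Longrightarrow> e x y = 0"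
    using max_invariant_pseudometric[OF X] by metis
  obtain Z R and \<pi> :: "'a \<Rightarrow> 'a set" where Z: "equicontinuous_system Z R" "factor_map X T Z R \<pi>"
    and dist: "\<And>x y. x \<in> mspace X \<Longrightarrow> y \<in> mspace X \<Longrightarrow> mdist Z (\<pi> x) (\<pi> y) = d x y"
    using invariant_pseudometric.quotient_system[OF d X] by metis
  have \<pi>: "continuous_map (mtopology_of X) (mtopology_of Z) \<pi>" "\<pi> ` mspace X = mspace Z"
    "\<And>x. x \<in> mspace X \<Longrightarrow> \<pi> (T x) = R (\<pi> x)"
    using Z(2) by (auto simp: factor_map_def)
  have TX: "T x \<in> mspace X" if "x \<in> mspace X" for x
    using system_bij_betw[OF X] that by (auto simp: bij_betw_def)
  \<comment> \<open>A continuous map from a compact to a Hausdorff space is closed; as a quotient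
    map, \<pi> lets continuity of \<psi> be tested on \<open>X\<close>.\<close>
  have q: "quotient_map (mtopology_of X) (mtopology_of Z) \<pi>"
    using \<pi> X continuous_imp_closed_map[OF \<pi>(1) _ Hausdorff_space_mtopology_of]
    by (simp add: continuous_closed_imp_quotient_map system_def)
  have "\<exists>\<psi>. factor_map Z R W Q \<psi> \<and> (\<forall>x\<in>mspace X. \<phi> x = \<psi> (\<pi> x))"
    if W: "equicontinuous_system W Q" and \<phi>: "factor_map X T W Q \<phi>" for W :: "'a set metric" and Q \<phi>
  proof -
    obtain e where e: "invariant_pseudometric X T e"
      "\<And>x y. x \<in> mspace X \<Longrightarrow> y \<in> mspace X \<Longrightarrow> e x y = 0 \<Longrightarrow> \<phi> x = \<phi> y"
      using equicontinuous_factor_pseudometric[OF X W \<phi>] by metis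
    define \<psi> where "\<psi> = \<phi> \<circ> inv_into (mspace X) \<pi>"
    have \<psi>: "\<psi> (\<pi> x) = \<phi> x" if x: "x \<in> mspace X" for x
    proof -
      define y where "y = inv_into (mspace X) \<pi> (\<pi> x)"
      have y: "y \<in> mspace X" "\<pi> y = \<pi> x"
        using x by (simp_all add: y_def inv_into_into f_inv_into_f)
      have "\<pi> x \<in> mspace Z" using \<pi>(2) x by blast
      then have "mdist Z (\<pi> y) (\<pi> x) = 0" using y(2) by simp
      then have "\<phi> y = \<phi> x" using dist e max x y(1) by metis
      then show ?thesis by (simp add: \<psi>_def y_def)
    qed
    have "continuous_map (mtopology_of Z) (mtopology_of W) \<psi>"
    proof (rule continuous_compose_quotient_map[OF q])
      have "continuous_map (mtopology_of X) (mtopology_of W) \<phi>" using \<phi> by (simp add: factor_map_def)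
      then show "continuous_map (mtopology_of X) (mtopology_of W) (\<psi> \<circ> \<pi>)"
        by (rule continuous_map_eq) (simp add: \<psi>)
    qed
    moreover have "\<psi> ` mspace Z = mspace W"
      using \<phi> \<psi> unfolding \<pi>(2)[symmetric] factor_map_def by (simp add: image_image)
    moreover have "\<forall>z\<in>mspace Z. \<psi> (R z) = Q (\<psi> z)"
      using \<phi> \<psi> TX \<pi>(3) unfolding \<pi>(2)[symmetric] factor_map_def by (metis imageE)
    ultimately show ?thesis using \<psi> by (auto simp: factor_map_def)
  qed
  then show ?thesis using Z unfolding max_equicontinuous_factor_def by blast
qed


section \<open>Inverse limits and their projections\<close>

text \<open>Coordinates below \<open>n\<close> are forced by the bonding maps, those above are
  chosen one preimage at a time. The induction drops the first space of the sequence until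
  \<open>a\<close> sits at index 0, where dependent choice applies.\<close>

lemma inverse_sequence_thread:
  assumes "\<And>n::nat. f n ` M (Suc n) = M n" and "a \<in> M n"
  shows "\<exists>s. s n = a \<and> (\<forall>k. s k \<in> M k \<and> f k (s (Suc k)) = s k)"
  using assms
proof (induction n arbitrary: M f)
  case 0
  have "\<exists>s. \<forall>k. (s k \<in> M k \<and> (k = 0 \<longrightarrow> s k = a)) \<and> f k (s (Suc k)) = s k"
  proof (rule dependent_nat_choice[where P = "\<lambda>k x. x \<in> M k \<and> (k = 0 \<longrightarrow> x = a)" and Q = "\<lambda>k x y. f k y = x"])
    show "\<exists>x. x \<in> M 0 \<and> (0 = (0::nat) \<longrightarrow> x = a)" using 0 by blast
    fix x and k :: nat assume "x \<in> M k \<and> (k = 0 \<longrightarrow> x = a)"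
    then have "x \<in> f k ` M (Suc k)" using 0 by blast
    then show "\<exists>y. (y \<in> M (Suc k) \<and> (Suc k = 0 \<longrightarrow> y = a)) \<and> f k y = x" by blast
  qed
  then show ?case by blast
next
  case (Suc n)
  obtain s where s: "s n = a" "\<And>k. s k \<in> M (Suc k)" "\<And>k. f (Suc k) (s (Suc k)) = s k"
    using Suc.IH[of "\<lambda>k. f (Suc k)" "\<lambda>k. M (Suc k)"] Suc.prems by blast
  \<comment> \<open>Restores the dropped coordinate at the front of the shifted thread
    \<open>s\<close>.\<close>
  define t where "t k = (case k of 0 \<Rightarrow> f 0 (s 0) | Suc j \<Rightarrow> s j)" for k
  have "t k \<in> M k \<and> f k (t (Suc k)) = t k" for k
    using s Suc.prems(1)[of 0] by (cases k) (auto simp: t_def)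
  moreover have "t (Suc n) = a" using s by (simp add: t_def)
  ultimately show ?case by blast
qed

lemma topspace_thread_space:
  "topspace (thread_space Xs f) = {s. \<forall>n. s n \<in> mspace (Xs n) \<and> f n (s (Suc n)) = s n}"
  by (auto simp: thread_space_def PiE_def Pi_def)

text \<open>Continuity is that of a coordinate of the thread map; surjectivity holds because each
  point of \<open>Xs n\<close> lies on a thread.\<close>

lemma inverse_limit_factor_map:
  assumes "inverse_limit X T Xs Ts f p"
  shows "factor_map X T (Xs n) (Ts n) (p n)"
  unfolding factor_map_def
proof (intro conjI)
  have h: "homeomorphic_map (mtopology_of X) (thread_space Xs f) (\<lambda>x n. p n x)"
    using assms by (simp add: inverse_limit_def)
  have "continuous_map (mtopology_of X) (product_topology (\<lambda>n. mtopology_of (Xs n)) UNIV) (\<lambda>x n. p n x)"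
    using homeomorphic_imp_continuous_map[OF h] unfolding thread_space_def
    by (rule continuous_map_into_fulltopology)
  then show "continuous_map (mtopology_of X) (mtopology_of (Xs n)) (p n)"
    by (simp add: continuous_map_componentwise_UNIV)
  have im: "(\<lambda>x n. p n x) ` mspace X = topspace (thread_space Xs f)"
    using homeomorphic_imp_surjective_map[OF h] by simp
  have fs: "f k ` mspace (Xs (Suc k)) = mspace (Xs k)" for k
    using assms by (simp add: inverse_limit_def factor_map_def)
  show "p n ` mspace X = mspace (Xs n)"
  proof
    show "p n ` mspace X \<subseteq> mspace (Xs n)"
      using im by (auto simp: topspace_thread_space)
    show "mspace (Xs n) \<subseteq> p n ` mspace X"
    proof
      fix a assume "a \<in> mspace (Xs n)"
      then obtain s where s: "s n = a" "s \<in> topspace (thread_space Xs f)"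
        using inverse_sequence_thread[of f "\<lambda>k. mspace (Xs k)", OF fs] by (auto simp: topspace_thread_space)
      then obtain x where "x \<in> mspace X" "s = (\<lambda>n. p n x)" unfolding im[symmetric] by blast
      then show "a \<in> p n ` mspace X" using s(1) by auto
    qed
  qed
  show "\<forall>x\<in>mspace X. p n (T x) = Ts n (p n x)"
    using assms by (simp add: inverse_limit_def)
qed

text \<open>For a point \<open>x\<close>, the parts of \<open>C\<close> lying over the coordinates
  \<open>p n x\<close> are nonempty, closed and nested. By compactness they share a point, which has
  the same thread as \<open>x\<close> and therefore equals \<open>x\<close>.\<close>

lemma inverse_limit_closed_subset_eq:
  assumes L: "inverse_limit X T Xs Ts f p" and C: "closedin (mtopology_of X) C"
    and im: "\<And>n. mspace (Xs n) \<subseteq> p n ` C"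
  shows "C = mspace X"
proof
  show CX: "C \<subseteq> mspace X" using closedin_subset[OF C] by simp
  have h: "homeomorphic_map (mtopology_of X) (thread_space Xs f) (\<lambda>x n. p n x)"
    and cX: "compact_space (mtopology_of X)"
    using L by (auto simp: inverse_limit_def system_def)
  note fm = inverse_limit_factor_map[OF L]
  have fp: "f n (p (Suc n) x) = p n x" if "x \<in> mspace X" for n x
    using homeomorphic_imp_surjective_map[OF h] that by (auto simp: topspace_thread_space)
  show "mspace X \<subseteq> C"
  proof
    fix x assume x: "x \<in> mspace X"
    define F where "F n = {z \<in> C. p n z = p n x}" for n
    have px: "p n x \<in> mspace (Xs n)" for n using fm[of n] x by (auto simp: factor_map_def)
    have "(\<Inter>n. F n) \<noteq> {}"
    proof (rule compact_space_imp_nest[OF cX])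
      fix n
      have "continuous_map (mtopology_of X) (mtopology_of (Xs n)) (p n)"
        using fm by (simp add: factor_map_def)
      moreover have "closedin (mtopology_of (Xs n)) {p n x}"
        using px by (intro closedin_Hausdorff_singleton Hausdorff_space_mtopology_of) simp
      ultimately have "closedin (mtopology_of X) {z \<in> mspace X. p n z \<in> {p n x}}"
        using closedin_continuous_map_preimage by fastforce
      then have "closedin (mtopology_of X) (C \<inter> {z \<in> mspace X. p n z \<in> {p n x}})"
        using C by (rule closedin_Int[rotated])
      also have "C \<inter> {z \<in> mspace X. p n z \<in> {p n x}} = F n" using CX by (auto simp: F_def)
      finally show "closedin (mtopology_of X) (F n)" .
      have "p n x \<in> p n ` C" using im px by blast
      then show "F n \<noteq> {}" by (force simp: F_def)
    next
      \<comment> \<open>Coordinate \<open>Suc n\<close> determines coordinate \<open>n\<close>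
        through \<open>f n\<close>.\<close>
      show "decseq F"
      proof (rule decseq_SucI)
        fix n show "F (Suc n) \<subseteq> F n"
          using fp x CX unfolding F_def by (auto; metis subsetD)
      qed
    qed
    then obtain z where z: "\<And>n. z \<in> F n" by blast
    have "z = x"
    proof (rule inj_onD)
      show "inj_on (\<lambda>x n. p n x) (mspace X)"
        using homeomorphic_imp_injective_map[OF h] by simp
      show "(\<lambda>n. p n z) = (\<lambda>n. p n x)" using z by (simp add: F_def)
      show "z \<in> mspace X" using z[of 0] CX by (auto simp: F_def)
    qed (rule x)
    then show "x \<in> C" using z[of 0] by (simp add: F_def)
  qed
qed

lemma closedin_image_compact:
  assumes "compact_space U" "Hausdorff_space V" "continuous_map U V g" "closedin U C"
  shows "closedin V (g ` C)"
  using assms by (meson closedin_compact_space compactin_imp_closedin image_compactin)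

text \<open>The image of an orbit closure in \<open>Xs n\<close> is closed and contains a dense
  orbit, so it is everything; the orbit closure is then all of \<open>X\<close>.\<close>

lemma inverse_limit_minimal:
  assumes L: "inverse_limit X T Xs Ts f p" and m: "\<And>n. minimal_system (Xs n) (Ts n)"
  shows "minimal_system X T"
  unfolding minimal_system_def
proof (intro conjI ballI)
  show X: "system X T" using L by (simp add: inverse_limit_def)
  note fm = inverse_limit_factor_map[OF L]
  fix x assume x: "x \<in> mspace X"
  let ?O = "range (\<lambda>k. iterate X T k x)"
  let ?C = "mtopology_of X closure_of ?O"
  show "?C = mspace X"
  proof (rule inverse_limit_closed_subset_eq[OF L])
    fix n
    have sn: "system (Xs n) (Ts n)" using m[of n] by (simp add: minimal_system_def)
    note it = iterate_semiconj[OF X sn fm x]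
    have "p n x \<in> mspace (Xs n)" using fm[of n] x by (auto simp: factor_map_def)
    then have "mspace (Xs n) = mtopology_of (Xs n) closure_of range (\<lambda>k. iterate (Xs n) (Ts n) k (p n x))"
      using m[of n] by (simp add: minimal_system_def)
    also have "range (\<lambda>k. iterate (Xs n) (Ts n) k (p n x)) = p n ` ?O"
      using it by (simp add: image_image)
    also have "mtopology_of (Xs n) closure_of (p n ` ?O) \<subseteq> p n ` ?C"
    proof (rule closure_of_minimal)
      show "p n ` ?O \<subseteq> p n ` ?C"
        using it by (intro image_mono closure_of_subset) auto
      show "closedin (mtopology_of (Xs n)) (p n ` ?C)"
        using fm[of n] X by (intro closedin_image_compact[of "mtopology_of X"] Hausdorff_space_mtopology_of)
          (auto simp: factor_map_def system_def)
    qed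
    finally show "mspace (Xs n) \<subseteq> p n ` ?C" .
  qed simp
qed

section \<open>Joinings\<close>

lemma joining_subset: "joining X T Y S J \<Longrightarrow> J \<subseteq> mspace X \<times> mspace Y"
  by (force simp: joining_def)

text \<open>The point is closedness of the image, which comes from compactness of the
  product.\<close>

lemma joining_factor:
  assumes X: "system X T" and Y: "system Y S" and \<pi>: "factor_map X T X' T' \<pi>" and J: "joining X T Y S J"
  shows "joining X' T' Y S (map_prod \<pi> id ` J)"
  unfolding joining_def
proof (intro conjI)
  note sub = joining_subset[OF J]
  have J': "closedin (prod_topology (mtopology_of X) (mtopology_of Y)) J" "map_prod T S ` J = J"
    "fst ` J = mspace X" "snd ` J = mspace Y"
    using J by (auto simp: joining_def)
  show "closedin (prod_topology (mtopology_of X') (mtopology_of Y)) (map_prod \<pi> id ` J)"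
  proof (rule closedin_image_compact[OF _ _ _ J'(1)])
    show "compact_space (prod_topology (mtopology_of X) (mtopology_of Y))"
      using X Y by (simp add: compact_space_prod_topology system_def)
    show "Hausdorff_space (prod_topology (mtopology_of X') (mtopology_of Y))"
      by (simp add: Hausdorff_space_prod_topology Hausdorff_space_mtopology_of)
    show "continuous_map (prod_topology (mtopology_of X) (mtopology_of Y))
        (prod_topology (mtopology_of X') (mtopology_of Y)) (map_prod \<pi> id)"
      using \<pi> by (auto simp: map_prod_def continuous_map_prod_top factor_map_def)
  qed
  have "map_prod T' S ` map_prod \<pi> id ` J = map_prod \<pi> id ` map_prod T S ` J"
    unfolding image_image using \<pi> sub by (intro image_cong) (auto simp: factor_map_def)
  then show "map_prod T' S ` map_prod \<pi> id ` J = map_prod \<pi> id ` J" by (simp add: J')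
  have "fst ` map_prod \<pi> id ` J = \<pi> ` fst ` J" by (simp add: image_image)
  then show "fst ` map_prod \<pi> id ` J = mspace X'" using \<pi> by (simp add: J' factor_map_def)
  have "snd ` map_prod \<pi> id ` J = snd ` J" by (simp add: image_image)
  then show "snd ` map_prod \<pi> id ` J = mspace Y" by (simp add: J')
qed

text \<open>If exactly one carrier were empty, the product would be empty and could not project onto
  the other; hence the condition on emptiness.\<close>

lemma joining_full:
  assumes "system X T" "system Y S" "mspace X = {} \<longleftrightarrow> mspace Y = {}"
  shows "joining X T Y S (mspace X \<times> mspace Y)"
  unfolding joining_def
proof (intro conjI)
  show "closedin (prod_topology (mtopology_of X) (mtopology_of Y)) (mspace X \<times> mspace Y)"
    using closedin_topspace[of "prod_topology (mtopology_of X) (mtopology_of Y)"] by simp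
  show "map_prod T S ` (mspace X \<times> mspace Y) = mspace X \<times> mspace Y"
    using system_bij_betw[OF assms(1)] system_bij_betw[OF assms(2)]
    by (simp add: map_prod_surj_on bij_betw_def)
qed (use assms in auto)

theorem lemma6p1:
  fixes X :: "'b metric" and T :: "'b \<Rightarrow> 'b"
    and Xs :: "nat \<Rightarrow> 'a metric" and Ts :: "nat \<Rightarrow> 'a \<Rightarrow> 'a"
    and f :: "nat \<Rightarrow> 'a \<Rightarrow> 'a" and p :: "nat \<Rightarrow> 'b \<Rightarrow> 'a"
    and Y :: "'c metric" and S :: "'c \<Rightarrow> 'c"
  assumes "\<And>n. minimal_system (Xs n) (Ts n)"
    and "inverse_limit X T Xs Ts f p"
    and "minimal_system Y S"
    and "\<And>n. quasi_disjoint (Xs n) (Ts n) Y S"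
  shows "quasi_disjoint X T Y S"
proof -
  note L = assms(2)
  note fm = inverse_limit_factor_map[OF L]
  have X: "system X T" using L by (simp add: inverse_limit_def)
  have Y: "system Y S" using assms(3) by (simp add: minimal_system_def)
  obtain Xe Te \<pi>X where mX: "max_equicontinuous_factor X T Xe Te \<pi>X"
    using max_equicontinuous_factor_exists[OF X] by blast
  obtain Ye Se \<pi>Y where mY: "max_equicontinuous_factor Y S Ye Se \<pi>Y"
    using max_equicontinuous_factor_exists[OF Y] by blast
  have fX: "factor_map X T Xe Te \<pi>X" and fY: "factor_map Y S Ye Se \<pi>Y"
    using mX mY by (auto simp: max_equicontinuous_factor_def)
  have step: "map_prod (p n) id ` J = mspace (Xs n) \<times> mspace Y"
    if J: "joining X T Y S J" and JE: "map_prod \<pi>X \<pi>Y ` J = mspace Xe \<times> mspace Ye" for J n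
  proof -
    \<comment> \<open>Quasi-disjointness supplies its own maximal factors for each \<open>n\<close>;
      \<open>B\<close> may differ from \<open>Ye\<close>, so it is reached from \<open>Ye\<close> by
      the universal property.\<close>
    obtain A a \<alpha> B b \<beta> where mA: "max_equicontinuous_factor (Xs n) (Ts n) A a \<alpha>"
      and mB: "max_equicontinuous_factor Y S B b \<beta>"
      and qd: "\<forall>J. joining (Xs n) (Ts n) Y S J \<and> map_prod \<alpha> \<beta> ` J = mspace A \<times> mspace B
             \<longleftrightarrow> J = mspace (Xs n) \<times> mspace Y"
      using assms(4)[of n] unfolding quasi_disjoint_def by (elim exE conjE) (rule that)
    have eA: "equicontinuous_system A a" "factor_map (Xs n) (Ts n) A a \<alpha>"
      and eB: "equicontinuous_system B b" "factor_map Y S B b \<beta>"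
      using mA mB by (auto simp: max_equicontinuous_factor_def)
    \<comment> \<open>\<open>A\<close> is an equicontinuous factor of \<open>X\<close> by way of
      \<open>Xs n\<close>, but its points have another type than those of \<open>Xe\<close>, so the
      type-independent form of universality is used.\<close>
    obtain u where u: "factor_map Xe Te A a u" "\<And>x. x \<in> mspace X \<Longrightarrow> \<alpha> (p n x) = u (\<pi>X x)"
      using max_equicontinuous_factor_universal[OF X mX eA(1) factor_map_compose[OF fm eA(2)]] by auto
    obtain v where v: "factor_map Ye Se B b v" "\<And>y. y \<in> mspace Y \<Longrightarrow> \<beta> y = v (\<pi>Y y)"
      using max_equicontinuous_factor_universal[OF Y mY eB] by auto
    have "map_prod \<alpha> \<beta> ` map_prod (p n) id ` J = map_prod u v ` map_prod \<pi>X \<pi>Y ` J"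
      unfolding image_image using u(2) v(2) joining_subset[OF J] by (intro image_cong) auto
    also have "\<dots> = mspace A \<times> mspace B"
      using u(1) v(1) unfolding JE by (intro map_prod_surj_on) (auto simp: factor_map_def)
    finally show ?thesis
      using qd[rule_format, of "map_prod (p n) id ` J"] joining_factor[OF X Y fm J] by simp
  qed
  \<comment> \<open>The equivalence in \<open>quasi_disjoint\<close> makes the full product of
    \<open>Xs 0\<close> and \<open>Y\<close> a joining, so neither can be empty without the
    other.\<close>
  have empty: "mspace X = {} \<longleftrightarrow> mspace Y = {}"
  proof -
    have "joining (Xs 0) (Ts 0) Y S (mspace (Xs 0) \<times> mspace Y)"
      using assms(4)[of 0] unfolding quasi_disjoint_def
      by (elim exE conjE) (drule spec[of _ "mspace (Xs 0) \<times> mspace Y"], simp)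
    then have "mspace (Xs 0) = {} \<longleftrightarrow> mspace Y = {}"
      unfolding joining_def by (metis Sigma_empty1 Sigma_empty2 image_empty)
    then show ?thesis using fm[of 0] by (auto simp: factor_map_def)
  qed
  have "joining X T Y S J \<and> map_prod \<pi>X \<pi>Y ` J = mspace Xe \<times> mspace Ye \<longleftrightarrow>
      J = mspace X \<times> mspace Y" for J
  proof
    assume *: "joining X T Y S J \<and> map_prod \<pi>X \<pi>Y ` J = mspace Xe \<times> mspace Ye"
    then have J: "joining X T Y S J" by blast
    \<comment> \<open>The section of \<open>J\<close> over \<open>y\<close> is closed, and by
      \<open>step\<close> it projects onto every \<open>Xs n\<close>.\<close>
    have "{x \<in> mspace X. (x, y) \<in> J} = mspace X" if y: "y \<in> mspace Y" for y
    proof (rule inverse_limit_closed_subset_eq[OF L])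
      have "continuous_map (mtopology_of X) (prod_topology (mtopology_of X) (mtopology_of Y)) (\<lambda>x. (x, y))"
        using y by (simp add: continuous_map_pairwise o_def)
      then show "closedin (mtopology_of X) {x \<in> mspace X. (x, y) \<in> J}"
        using closedin_continuous_map_preimage[of "mtopology_of X" _ "\<lambda>x. (x, y)" J] J
        by (fastforce simp: joining_def)
      fix n
      show "mspace (Xs n) \<subseteq> p n ` {x \<in> mspace X. (x, y) \<in> J}"
      proof
        fix a assume "a \<in> mspace (Xs n)"
        then have "(a, y) \<in> map_prod (p n) id ` J" using step[of J n] * y by blast
        then show "a \<in> p n ` {x \<in> mspace X. (x, y) \<in> J}"
          using joining_subset[OF J] by force
      qed
    qed
    then show "J = mspace X \<times> mspace Y" using joining_subset[OF J] by blast
  next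
    assume J: "J = mspace X \<times> mspace Y"
    then show "joining X T Y S J \<and> map_prod \<pi>X \<pi>Y ` J = mspace Xe \<times> mspace Ye"
      using joining_full[OF X Y empty] fX fY
      by (simp add: map_prod_surj_on factor_map_def)
  qed
  then show ?thesis
    using inverse_limit_minimal[OF L assms(1)] assms(3) mX mY
    unfolding quasi_disjoint_def by (intro conjI exI allI) assumption+
qed

end
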